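(* 1) Let $f$ be a piecewise contracting interval map with $N\geqslant 2$ contraction pieces which satisfies the separation property, let $x\in\widetilde X$ and let $\theta$ be the itinerary of $x$. Then there exist $\alpha\in\{0,1,\dots,N-1\}$, $\beta\geqslant 1$ and $m_0\geqslant 1$ such that \[ p(\theta,n)=\alpha n+\beta\qquad\forall\, n\geqslant m_0, \] with $\beta=1$ if $\alpha=N-1$. 2) For every $N\geqslant 2$ there exists a piecewise affine contracting interval map $f$ (i.e. $f$ is affine on each contraction piece) which has $N$ contraction pieces and satisfies the separation property, such that \[ p(\theta,n)=(N-1)n+1\qquad\forall\, n\geqslant 1 \] for every itinerary $\theta$ of $f$.
   Context: Let $(X,d)$ be a compact metric space and $X_1,\dots,X_N$ ($N\geqslant 2$) be non-empty pairwise disjoint open subsets of $X$ with $X=\bigcup_{i=1}^N\overline{X_i}$. Let $\Delta:=\{x\in\overline{X_i}\cap\overline{X_j}: i\neq j\}$. A map $f:X\to X$ is a piecewise contracting map with contraction pieces $X_1,\dots,X_N$ if $f$ is discontinuous at every point of $\Delta$ and there is $\lambda\in(0,1)$ such that $d(f(x),f(y))\leqslant\lambda d(x,y)$ for all $x,y$ in the same $X_i$. Then each $f|_{X_i}$ has a continuous extension $f_i:\overline{X_i}\to X$. The map $f$ satisfies the separation property if each $f_i$ is injective and $f_i(\overline{X_i})\cap f_j(\overline{X_j})=\emptyset$ for all $i\neq j$. A piecewise contracting interval map is a piecewise contracting map where $X$ is a compact interval of $\mathbb{R}$ and each contraction piece is an interval open in $X$. Let $\widetilde X:=\bigcap_{n\geqslant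 0}f^{-n}(X\setminus\Delta)$ (assumed non-empty). The itinerary of $x\in\widetilde X$ is the sequence $\theta=(\theta_t)_{t\in\mathbb{N}}\in\{1,\dots,N\}^{\mathbb{N}}$ with $\theta_t=i$ iff $f^t(x)\in X_i$; an itinerary of $f$ means the itinerary of some point of $\widetilde X$. For a sequence $\theta$ and $n\geqslant 1$, $L_n(\theta):=\{\theta_t\theta_{t+1}\dots\theta_{t+n-1}: t\geqslant 0\}$ and the complexity function is $p(\theta,n):=\#L_n(\theta)$. Here $\mathbb{N}=\{0,1,2,\dots\}$. *)

theory Defs
  imports "HOL-Analysis.Analysis"
begin

definition disc_set :: "nat \<Rightarrow> (nat \<Rightarrow> real set) \<Rightarrow> real set" where
  "disc_set N P = {x. \<exists>i\<in>{1..N}. \<exists>j\<in>{1..N}. i \<noteq> j \<and> x \<in> closure (P i) \<and> x \<in> closure (P j)}"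

definition piecewise_contracting_interval_map ::
  "real set \<Rightarrow> nat \<Rightarrow> (nat \<Rightarrow> real set) \<Rightarrow> (real \<Rightarrow> real) \<Rightarrow> bool" where
  "piecewise_contracting_interval_map X N P f \<longleftrightarrow>
     N \<ge> 2 \<and>
     compact X \<and> is_interval X \<and> X \<noteq> {} \<and>
     (\<forall>i\<in>{1..N}. P i \<noteq> {} \<and> is_interval (P i) \<and> openin (top_of_set X) (P i)) \<and>
     (\<forall>i\<in>{1..N}. \<forall>j\<in>{1..N}. i \<noteq> j \<longrightarrow> P i \<inter> P j = {}) \<and>
     X = (\<Union>i\<in>{1..N}. closure (P i)) \<and>
     f ` X \<subseteq> X \<and>
     (\<forall>x\<in>disc_set N P. \<not> continuous (at x within X) f) \<and>
     (\<exists>lam::real. 0 < lam \<and> lam < 1 \<and>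
        (\<forall>i\<in>{1..N}. \<forall>x\<in>P i. \<forall>y\<in>P i. dist (f x) (f y) \<le> lam * dist x y))"

text \<open>Separation property: the continuous extensions f_i of f restricted to the pieces
  (which are unique) are injective on the closures and have pairwise disjoint images.\<close>
definition separation_property ::
  "nat \<Rightarrow> (nat \<Rightarrow> real set) \<Rightarrow> (real \<Rightarrow> real) \<Rightarrow> bool" where
  "separation_property N P f \<longleftrightarrow>
     (\<exists>g :: nat \<Rightarrow> real \<Rightarrow> real.
        (\<forall>i\<in>{1..N}. continuous_on (closure (P i)) (g i) \<and> (\<forall>x\<in>P i. g i x = f x)
                      \<and> inj_on (g i) (closure (P i))) \<and>
        (\<forall>i\<in>{1..N}. \<forall>j\<in>{1..N}. i \<noteq> j \<longrightarrow> g i ` closure (P i) \<inter> g j ` closure (P j) = {}))"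

definition Xtilde :: "real set \<Rightarrow> nat \<Rightarrow> (nat \<Rightarrow> real set) \<Rightarrow> (real \<Rightarrow> real) \<Rightarrow> real set" where
  "Xtilde X N P f = {x \<in> X. \<forall>n. (f ^^ n) x \<in> X - disc_set N P}"

definition is_itinerary ::
  "nat \<Rightarrow> (nat \<Rightarrow> real set) \<Rightarrow> (real \<Rightarrow> real) \<Rightarrow> real \<Rightarrow> (nat \<Rightarrow> nat) \<Rightarrow> bool" where
  "is_itinerary N P f x \<theta> \<longleftrightarrow> (\<forall>t. \<theta> t \<in> {1..N} \<and> (f ^^ t) x \<in> P (\<theta> t))"

definition factors :: "(nat \<Rightarrow> nat) \<Rightarrow> nat \<Rightarrow> nat list set" where
  "factors \<theta> n = (\<lambda>t. map (\<lambda>k. \<theta> (t + k)) [0..<n]) ` UNIV"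

definition complexity :: "(nat \<Rightarrow> nat) \<Rightarrow> nat \<Rightarrow> nat" where
  "complexity \<theta> n = card (factors \<theta> n)"

end

theory Submission
  imports Defs
begin

text \<open>
  Call a letter special at level \<open>n\<close> if it follows some factor of length \<open>n\<close> of the itinerary
  without being the rightmost piece that does. Extending a common word by two different letters forces the right
  endpoint of the left one of the two pieces into the atom of that word. By the separation property
  atoms of distinct words of length \<open>n\<close> are disjoint, so a special letter determines the word it
  follows, and \<open>p(n+1) - p(n)\<close> is the number of special letters at level \<open>n\<close>. Dropping the first
  letter of a word shows that the set of special letters decreases with \<open>n\<close>; it never contains the
  rightmost piece, and \<open>p(0) = 1\<close>. This gives the affine form of \<open>p\<close> together with the bounds on
  \<open>\<alpha>\<close> and \<open>\<beta>\<close>.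

  For the extremal example put \<open>M = N - 1\<close> and blow up the rotation by an irrational \<open>\<rho>\<close> on the circle
  of length \<open>M\<close>, cut at the integers and at the preimage \<open>M - \<rho>\<close> of \<open>0\<close>: inserting gaps along the
  forward orbits of the integer points turns it into a map of slope \<open>1/2\<close> on every piece. Every
  orbit shadows an orbit of the rotation, which is dense, and the backward orbits of the \<open>M\<close> interior cuts
  do not meet. Hence every letter but the rightmost is special at every level.
\<close>

section \<open>Complexity and ordered special letters\<close>

definition agree :: "(nat \<Rightarrow> nat) \<Rightarrow> nat \<Rightarrow> nat \<Rightarrow> nat \<Rightarrow> bool" where
  "agree \<theta> n t s \<longleftrightarrow> (\<forall>k<n. \<theta> (t + k) = \<theta> (s + k))"

text \<open>The key \<open>q\<close> carries the left-to-right order of the pieces, because their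
  labels need not increase along the line.\<close>

definition special_letters :: "(nat \<Rightarrow> nat) \<Rightarrow> (nat \<Rightarrow> real) \<Rightarrow> nat \<Rightarrow> nat set" where
  "special_letters \<theta> q n =
     {\<theta> (t + n) |t. \<exists>s. agree \<theta> n t s \<and> q (\<theta> (t + n)) < q (\<theta> (s + n))}"

lemma agree_iff_map:
  "agree \<theta> n t s \<longleftrightarrow> map (\<lambda>k. \<theta> (t + k)) [0..<n] = map (\<lambda>k. \<theta> (s + k)) [0..<n]"
  by (auto simp: agree_def list_eq_iff_nth_eq)

lemma agree_Suc_shift: "agree \<theta> (Suc n) t s \<Longrightarrow> agree \<theta> n (Suc t) (Suc s)"
  unfolding agree_def by (metis Suc_less_eq add_Suc add_Suc_right)

lemma complexity_0: "complexity \<theta> 0 = 1"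
  by (simp add: complexity_def factors_def)

lemma finite_factors:
  assumes "finite (range \<theta>)"
  shows "finite (factors \<theta> n)"
proof (rule finite_subset)
  show "factors \<theta> n \<subseteq> {xs. set xs \<subseteq> range \<theta> \<and> length xs = n}"
    by (auto simp: factors_def)
qed (rule finite_lists_length_eq[OF assms])

lemma special_letters_antimono_Suc: "special_letters \<theta> q (Suc n) \<subseteq> special_letters \<theta> q n"
proof
  fix i
  assume "i \<in> special_letters \<theta> q (Suc n)"
  then obtain t s where ts: "i = \<theta> (t + Suc n)" "agree \<theta> (Suc n) t s"
      "q (\<theta> (t + Suc n)) < q (\<theta> (s + Suc n))"
    by (auto simp: special_letters_def)
  then show "i \<in> special_letters \<theta> q n"
    using agree_Suc_shift[of \<theta> n t s] unfolding special_letters_def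
    by (intro CollectI exI[of _ "Suc t"] conjI exI[of _ "Suc s"]) auto
qed

text \<open>Words of length \<open>n + 1\<close> split according to whether the last letter has the
  largest key among all continuations of its prefix. Deleting the last letter maps the maximal ones
  bijectively onto the words of length \<open>n\<close>; reading it maps the others bijectively onto
  the special letters, with injectivity supplied by \<open>unique\<close>.\<close>

lemma complexity_Suc:
  assumes fin: "finite (range \<theta>)" and inj: "inj_on q (range \<theta>)"
    and unique: "\<And>t s t' s'. \<lbrakk>agree \<theta> n t s; agree \<theta> n t' s'; \<theta> (t + n) = \<theta> (t' + n);
        q (\<theta> (t + n)) < q (\<theta> (s + n)); q (\<theta> (t' + n)) < q (\<theta> (s' + n))\<rbrakk> \<Longrightarrow> agree \<theta> n t t'"
  shows "complexity \<theta> (Suc n) = complexity \<theta> n + card (special_letters \<theta> q n)"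
proof -
  define w where "w = (\<lambda>t. map (\<lambda>k. \<theta> (t + k)) [0..<n])"
  define W where "W = (\<lambda>t. w t @ [\<theta> (t + n)])"
  define top where "top = (\<lambda>t. \<forall>s. agree \<theta> n t s \<longrightarrow> q (\<theta> (s + n)) \<le> q (\<theta> (t + n)))"
  have agree_w: "agree \<theta> n t s \<longleftrightarrow> w t = w s" for t s
    by (simp add: w_def agree_iff_map)
  have fac: "factors \<theta> n = range w" and fac_Suc: "factors \<theta> (Suc n) = range W"
    by (auto simp: factors_def w_def W_def)
  have split: "range W = W ` {t. top t} \<union> W ` {t. \<not> top t}"
    by blast
  have disj: "W ` {t. top t} \<inter> W ` {t. \<not> top t} = {}"
    by (auto simp: W_def top_def agree_w)
  have "bij_betw butlast (W ` {t. top t}) (range w)"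
  proof (rule bij_betw_imageI)
    show "inj_on butlast (W ` {t. top t})"
    proof (rule inj_onI)
      fix u v
      assume "u \<in> W ` {t. top t}" "v \<in> W ` {t. top t}" "butlast u = butlast v"
      then obtain t s where "u = W t" "v = W s" "top t" "top s" "w t = w s"
        by (auto simp: W_def)
      then have "q (\<theta> (t + n)) = q (\<theta> (s + n))"
        by (metis agree_w order_antisym top_def)
      then have "\<theta> (t + n) = \<theta> (s + n)"
        using inj by (simp add: inj_on_eq_iff)
      with \<open>u = W t\<close> \<open>v = W s\<close> \<open>w t = w s\<close> show "u = v"
        by (simp add: W_def)
    qed
    show "butlast ` W ` {t. top t} = range w"
    proof
      show "range w \<subseteq> butlast ` W ` {t. top t}"
      proof
        fix u assume "u \<in> range w"
        then obtain t where u: "u = w t" by blast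
        \<comment> \<open>\<open>E\<close> collects the keys of the letters that follow
          \<open>u\<close>; the alphabet is finite, so the maximum is attained at some occurrence of
          \<open>u\<close>.\<close>
        define E where "E = (\<lambda>s. q (\<theta> (s + n))) ` {s. w s = u}"
        have "E \<subseteq> q ` range \<theta>" by (auto simp: E_def)
        then have "finite E" using fin finite_subset by blast
        moreover have "E \<noteq> {}" using u by (auto simp: E_def)
        ultimately have "Max E \<in> E" "\<forall>e\<in>E. e \<le> Max E" by auto
        then obtain s where "w s = u" "\<And>r. w r = u \<Longrightarrow> q (\<theta> (r + n)) \<le> q (\<theta> (s + n))"
          by (auto simp: E_def)
        then have "top s" "butlast (W s) = u"
          by (auto simp: top_def W_def agree_w)
        then show "u \<in> butlast ` W ` {t. top t}" by blast
      qed
    qed (auto simp: W_def)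
  qed
  then have c1: "card (W ` {t. top t}) = complexity \<theta> n"
    by (simp add: bij_betw_same_card complexity_def fac)
  have "bij_betw last (W ` {t. \<not> top t}) (special_letters \<theta> q n)"
  proof (rule bij_betw_imageI)
    show "inj_on last (W ` {t. \<not> top t})"
    proof (rule inj_onI)
      fix u v
      assume "u \<in> W ` {t. \<not> top t}" "v \<in> W ` {t. \<not> top t}" "last u = last v"
      then obtain t t' where *: "u = W t" "v = W t'" "\<not> top t" "\<not> top t'" "\<theta> (t + n) = \<theta> (t' + n)"
        by (auto simp: W_def)
      then have "agree \<theta> n t t'"
        using unique unfolding top_def by (meson not_le)
      then show "u = v"
        using * by (simp add: W_def agree_w)
    qed
    show "last ` W ` {t. \<not> top t} = special_letters \<theta> q n"
      unfolding W_def special_letters_def top_def image_image by (auto simp: not_le)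
  qed
  then have c2: "card (W ` {t. \<not> top t}) = card (special_letters \<theta> q n)"
    by (rule bij_betw_same_card)
  have "finite (range W)"
    using finite_factors[OF fin, of "Suc n"] fac_Suc by simp
  then have "card (range W) = card (W ` {t. top t}) + card (W ` {t. \<not> top t})"
    unfolding split by (intro card_Un_disjoint disj) (auto intro: finite_subset)
  then show ?thesis
    by (simp add: c1 c2 complexity_def fac_Suc)
qed

text \<open>The increments are nonincreasing natural numbers, hence eventually equal to their
  minimum \<alpha>. Summation from \<open>p 0 = 1\<close> gives
  \<open>\<alpha> * n + 1 \<le> p n \<le> K * n + 1\<close>, so \<open>\<beta> \<ge> 1\<close>, and
  the two bounds coincide when \<open>\<alpha> = K\<close>.\<close>

lemma eventually_affine:
  fixes p d :: "nat \<Rightarrow> nat"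
  assumes p0: "p 0 = 1" and step: "\<And>n. p (Suc n) = p n + d n"
    and anti: "\<And>n. d (Suc n) \<le> d n" and bound: "\<And>n. d n \<le> K"
  shows "\<exists>\<alpha> \<beta> m0. \<alpha> \<le> K \<and> \<beta> \<ge> 1 \<and> m0 \<ge> 1 \<and> (\<forall>n\<ge>m0. p n = \<alpha> * n + \<beta>) \<and> (\<alpha> = K \<longrightarrow> \<beta> = 1)"
proof -
  define \<alpha> where "\<alpha> = (LEAST a. a \<in> range d)"
  have "\<alpha> \<in> range d"
    unfolding \<alpha>_def by (rule LeastI[of _ "d 0"]) simp
  then obtain k where k: "d k = \<alpha>" by blast
  have min: "\<alpha> \<le> d n" for n
    unfolding \<alpha>_def by (rule Least_le) simp
  have const: "d n = \<alpha>" if "n \<ge> k" for n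
    using that k min[of n] lift_Suc_antimono_le[of d k n] anti by (metis le_antisym)
  \<comment> \<open>The successor makes the threshold at least 1 even when
    \<open>k = 0\<close>.\<close>
  define m where "m = Suc k"
  have lower: "\<alpha> * n + 1 \<le> p n" for n
  proof (induction n)
    case (Suc n)
    then show ?case using step[of n] min[of n] by simp
  qed (simp add: p0)
  have upper: "p n \<le> K * n + 1" for n
  proof (induction n)
    case (Suc n)
    then show ?case using step[of n] bound[of n] by simp
  qed (simp add: p0)
  define \<beta> where "\<beta> = p m - \<alpha> * m"
  have pm: "p m = \<alpha> * m + \<beta>" "\<beta> \<ge> 1"
    using lower[of m] by (auto simp: \<beta>_def)
  have "p n = \<alpha> * n + \<beta>" if "n \<ge> m" for n
    using that
  proof (induction n rule: dec_induct)
    case (step n)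
    then show ?case using assms(2)[of n] const[of n] by (simp add: m_def)
  qed (rule pm(1))
  moreover have "\<alpha> = K \<Longrightarrow> \<beta> = 1"
    using upper[of m] pm by auto
  ultimately show ?thesis
    using pm(2) k bound[of k] by (intro exI[of _ \<alpha>] exI[of _ \<beta>] exI[of _ m]) (auto simp: m_def)
qed

section \<open>Maps with the separation property\<close>

text \<open>The points reached after \<open>n\<close> steps along the closed branches prescribed by
  \<open>u\<close>: a forward image, located at time \<open>n\<close> and not at the start of the
  word.\<close>

primrec atom ::
  "real set \<Rightarrow> (nat \<Rightarrow> real set) \<Rightarrow> (nat \<Rightarrow> real \<Rightarrow> real) \<Rightarrow> (nat \<Rightarrow> nat) \<Rightarrow> nat \<Rightarrow> real set" where
  "atom X P g u 0 = X"
| "atom X P g u (Suc n) = g (u n) ` (atom X P g u n \<inter> closure (P (u n)))"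

lemma atom_cong: "(\<And>k. k < n \<Longrightarrow> u k = v k) \<Longrightarrow> atom X P g u n = atom X P g v n"
  by (induction n) auto

locale separated_branches =
  fixes X :: "real set" and N :: nat and P :: "nat \<Rightarrow> real set" and f :: "real \<Rightarrow> real"
    and g :: "nat \<Rightarrow> real \<Rightarrow> real"
  assumes interval_X: "is_interval X" and bounded_X: "bounded X"
    and piece_subset: "i \<in> {1..N} \<Longrightarrow> P i \<subseteq> X"
    and piece_nonempty: "i \<in> {1..N} \<Longrightarrow> P i \<noteq> {}"
    and piece_interval: "i \<in> {1..N} \<Longrightarrow> is_interval (P i)"
    and piece_disjoint: "i \<in> {1..N} \<Longrightarrow> j \<in> {1..N} \<Longrightarrow> i \<noteq> j \<Longrightarrow> P i \<inter> P j = {}"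
    and cont_g: "i \<in> {1..N} \<Longrightarrow> continuous_on (closure (P i)) (g i)"
    and g_eq: "i \<in> {1..N} \<Longrightarrow> x \<in> P i \<Longrightarrow> g i x = f x"
    and inj_g: "i \<in> {1..N} \<Longrightarrow> inj_on (g i) (closure (P i))"
    and g_disjoint: "i \<in> {1..N} \<Longrightarrow> j \<in> {1..N} \<Longrightarrow> i \<noteq> j \<Longrightarrow>
      g i ` closure (P i) \<inter> g j ` closure (P j) = {}"
begin

lemma interval_atom:
  assumes "\<And>k. k < n \<Longrightarrow> u k \<in> {1..N}"
  shows "is_interval (atom X P g u n)"
  using assms
proof (induction n)
  case (Suc n)
  then have u: "u n \<in> {1..N}" by blast
  have "is_interval (closure (P (u n)))"
    using piece_interval[OF u] by (simp add: is_interval_convex_1 convex_closure)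
  then have "connected (atom X P g u n \<inter> closure (P (u n)))"
    using Suc by (intro is_interval_connected is_interval_Int) auto
  then have "connected (g (u n) ` (atom X P g u n \<inter> closure (P (u n))))"
    by (rule connected_continuous_image[OF continuous_on_subset[OF cont_g[OF u]], rotated]) auto
  then show ?case
    by (simp add: is_interval_connected_1)
qed (simp add: interval_X)

text \<open>Disjointness of the branch images recovers the last letter from \<open>z\<close>;
  injectivity of that branch then recovers the preimage, to which the induction hypothesis
  applies.\<close>

lemma atom_determines_word:
  assumes "z \<in> atom X P g u n" "z \<in> atom X P g v n"
    and "\<And>k. k < n \<Longrightarrow> u k \<in> {1..N}" "\<And>k. k < n \<Longrightarrow> v k \<in> {1..N}" "k < n"
  shows "u k = v k"
  using assms
proof (induction n arbitrary: z)
  case (Suc n)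
  from Suc.prems obtain a b where ab: "z = g (u n) a" "a \<in> atom X P g u n" "a \<in> closure (P (u n))"
      "z = g (v n) b" "b \<in> atom X P g v n" "b \<in> closure (P (v n))"
    by fastforce
  have mem: "u n \<in> {1..N}" "v n \<in> {1..N}"
    using Suc.prems by blast+
  have eq: "u n = v n"
    using g_disjoint[OF mem] ab by fastforce
  then have "a = b"
    using inj_g[OF mem(1)] ab by (auto dest: inj_onD)
  then show ?case
    using Suc.IH[of a] Suc.prems ab eq less_Suc_eq by auto
qed simp

lemma orbit_in_atom:
  assumes "is_itinerary N P f x \<theta>"
  shows "(f ^^ (t + n)) x \<in> atom X P g (\<lambda>k. \<theta> (t + k)) n"
proof (induction n)
  case 0
  then show ?case using assms piece_subset by (fastforce simp: is_itinerary_def)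
next
  case (Suc n)
  have "(f ^^ (t + n)) x \<in> P (\<theta> (t + n))" "\<theta> (t + n) \<in> {1..N}"
    using assms by (auto simp: is_itinerary_def)
  then show ?case
    using Suc g_eq closure_subset by (auto intro!: image_eqI[of _ _ "(f ^^ (t + n)) x"])
qed

lemma complexity_Suc_itinerary:
  assumes it: "is_itinerary N P f x \<theta>" and inj: "inj_on q {1..N}"
    and order: "\<And>i j y z. \<lbrakk>i \<in> {1..N}; j \<in> {1..N}; q i < q j; y \<in> P i; z \<in> P j\<rbrakk> \<Longrightarrow> y < z"
  shows "complexity \<theta> (Suc n) = complexity \<theta> n + card (special_letters \<theta> q n)"
proof (rule complexity_Suc)
  have mem: "\<theta> t \<in> {1..N}" and orb: "(f ^^ t) x \<in> P (\<theta> t)" for t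
    using it by (auto simp: is_itinerary_def)
  have range: "range \<theta> \<subseteq> {1..N}"
    using mem by auto
  then show "finite (range \<theta>)" "inj_on q (range \<theta>)"
    using finite_subset inj inj_on_subset by blast+
  \<comment> \<open>The orbit points at times \<open>t + n\<close> and \<open>s + n\<close> lie in
    the same atom, with the supremum of the left piece between them; the atom is an interval and so
    contains this supremum.\<close>
  have Sup_in: "Sup (P (\<theta> (t + n))) \<in> atom X P g (\<lambda>k. \<theta> (t + k)) n"
    if "agree \<theta> n t s" "q (\<theta> (t + n)) < q (\<theta> (s + n))" for t s
  proof -
    let ?S = "P (\<theta> (t + n))"
    have "atom X P g (\<lambda>k. \<theta> (s + k)) n = atom X P g (\<lambda>k. \<theta> (t + k)) n"
      using that(1) by (intro atom_cong) (simp add: agree_def)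
    then have "(f ^^ (s + n)) x \<in> atom X P g (\<lambda>k. \<theta> (t + k)) n"
      using orbit_in_atom[OF it, of s n] by simp
    moreover have "y \<le> (f ^^ (s + n)) x" if "y \<in> ?S" for y
      using order[OF mem mem \<open>q (\<theta> (t + n)) < q (\<theta> (s + n))\<close> that orb] by simp
    then have "Sup ?S \<le> (f ^^ (s + n)) x"
      using orb by (intro cSup_least) auto
    moreover have "bdd_above ?S"
      using bounded_subset[OF bounded_X piece_subset[OF mem]] by (rule bounded_imp_bdd_above)
    then have "(f ^^ (t + n)) x \<le> Sup ?S"
      by (rule cSup_upper[OF orb])
    ultimately show ?thesis
      using interval_atom[of n "\<lambda>k. \<theta> (t + k)"] mem orbit_in_atom[OF it, of t n]
      unfolding is_interval_1 by blast
  qed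
  fix t s t' s'
  assume "agree \<theta> n t s" "agree \<theta> n t' s'" and eq: "\<theta> (t + n) = \<theta> (t' + n)"
    and "q (\<theta> (t + n)) < q (\<theta> (s + n))" "q (\<theta> (t' + n)) < q (\<theta> (s' + n))"
  \<comment> \<open>Equal letters give both words the same endpoint, so their atoms meet.\<close>
  then have "Sup (P (\<theta> (t + n))) \<in> atom X P g (\<lambda>k. \<theta> (t + k)) n"
    "Sup (P (\<theta> (t + n))) \<in> atom X P g (\<lambda>k. \<theta> (t' + k)) n"
    using Sup_in[of t s] Sup_in[of t' s'] by auto
  then show "agree \<theta> n t t'"
    unfolding agree_def using mem
    by (blast intro: atom_determines_word[of _ "\<lambda>k. \<theta> (t + k)" n "\<lambda>k. \<theta> (t' + k)"])
qed

text \<open>One pair of sample points decides the order of two disjoint intervals: if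
  \<open>z \<le> y\<close>, then either \<open>a\<close> lies between two points of
  \<open>P j\<close> or \<open>z\<close> lies between two points of \<open>P i\<close>.\<close>

lemma piece_order:
  assumes ij: "i \<in> {1..N}" "j \<in> {1..N}" and "a \<in> P i" "b \<in> P j" "a < b" "i \<noteq> j"
    and "y \<in> P i" "z \<in> P j"
  shows "y < z"
proof (rule ccontr)
  assume "\<not> y < z"
  then have "z \<le> y" by simp
  have Pi: "r \<in> P i" if "u \<in> P i" "v \<in> P i" "u \<le> r" "r \<le> v" for u v r
    using piece_interval[OF ij(1)] that unfolding is_interval_1 by blast
  have Pj: "r \<in> P j" if "u \<in> P j" "v \<in> P j" "u \<le> r" "r \<le> v" for u v r
    using piece_interval[OF ij(2)] that unfolding is_interval_1 by blast
  have no: "\<not> (r \<in> P i \<and> r \<in> P j)" for r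
    using piece_disjoint[OF ij \<open>i \<noteq> j\<close>] by blast
  show False
  proof (cases "z \<le> a")
    case True
    then show False using Pj[of z b a] no assms by auto
  next
    case False
    then show False using Pi[of a y z] no assms \<open>z \<le> y\<close> by auto
  qed
qed

theorem complexity_eventually_affine:
  assumes it: "is_itinerary N P f x \<theta>"
  shows "\<exists>\<alpha> \<beta> m0. \<alpha> \<le> N - 1 \<and> \<beta> \<ge> 1 \<and> m0 \<ge> 1 \<and>
    (\<forall>n\<ge>m0. complexity \<theta> n = \<alpha> * n + \<beta>) \<and> (\<alpha> = N - 1 \<longrightarrow> \<beta> = 1)"
proof (rule eventually_affine)
  \<comment> \<open>An arbitrary sample point of each piece serves as its key; disjointness makes
    the keys distinct, and \<open>piece_order\<close> makes them reflect the position of whole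
    pieces.\<close>
  define q where "q i = (SOME y. y \<in> P i)" for i
  have q: "q i \<in> P i" if "i \<in> {1..N}" for i
    using piece_nonempty[OF that] by (simp add: q_def some_in_eq)
  have mem: "\<theta> t \<in> {1..N}" for t
    using it by (auto simp: is_itinerary_def)
  have inj: "inj_on q {1..N}"
    by (rule inj_onI) (metis q piece_disjoint disjoint_iff)
  have "y < z" if "i \<in> {1..N}" "j \<in> {1..N}" "q i < q j" "y \<in> P i" "z \<in> P j" for i j y z
    using piece_order[OF that(1,2) q[OF that(1)] q[OF that(2)]] that by auto
  then show "complexity \<theta> (Suc n) = complexity \<theta> n + card (special_letters \<theta> q n)" for n
    by (rule complexity_Suc_itinerary[OF it inj])
  have sub: "special_letters \<theta> q n \<subseteq> {1..N}" for n
    using mem by (auto simp: special_letters_def)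
  then show "card (special_letters \<theta> q (Suc n)) \<le> card (special_letters \<theta> q n)" for n
    by (intro card_mono special_letters_antimono_Suc finite_subset[OF sub]) auto
  show "card (special_letters \<theta> q n) \<le> N - 1" for n
  proof -
    have "Max (q ` {1..N}) \<in> q ` {1..N}"
      using mem[of 0] by (intro Max_in) auto
    then obtain m where m: "m \<in> {1..N}" "q m = Max (q ` {1..N})"
      by auto
    \<comment> \<open>No piece has a larger key than piece \<open>m\<close>, so \<open>m\<close> is
      never special and at most \<open>N - 1\<close> letters are.\<close>
    have "q i \<le> q m" if "i \<in> {1..N}" for i
      using that m(2) by simp
    then have "m \<notin> special_letters \<theta> q n"
      using mem by (force simp: special_letters_def not_less[symmetric])
    then have "special_letters \<theta> q n \<subseteq> {1..N} - {m}"
      using sub by auto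
    then have "card (special_letters \<theta> q n) \<le> card ({1..N} - {m})"
      by (intro card_mono) auto
    then show ?thesis using m(1) by simp
  qed
qed (rule complexity_0)

end

lemma separated_branches_exist:
  assumes "piecewise_contracting_interval_map X N P f" "separation_property N P f"
  obtains g where "separated_branches X N P f g"
proof -
  from assms(2) obtain g where g: "\<forall>i\<in>{1..N}. continuous_on (closure (P i)) (g i) \<and>
        (\<forall>x\<in>P i. g i x = f x) \<and> inj_on (g i) (closure (P i))"
      "\<forall>i\<in>{1..N}. \<forall>j\<in>{1..N}. i \<noteq> j \<longrightarrow> g i ` closure (P i) \<inter> g j ` closure (P j) = {}"
    unfolding separation_property_def by blast
  have X: "is_interval X" "compact X"
      "\<forall>i\<in>{1..N}. P i \<noteq> {} \<and> is_interval (P i) \<and> openin (top_of_set X) (P i)"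
      "\<forall>i\<in>{1..N}. \<forall>j\<in>{1..N}. i \<noteq> j \<longrightarrow> P i \<inter> P j = {}"
    using assms(1) unfolding piecewise_contracting_interval_map_def by blast+
  have sub: "P i \<subseteq> X" if "i \<in> {1..N}" for i
    using X(3) that openin_imp_subset by metis
  have "separated_branches X N P f g"
  proof
    show "is_interval X" "bounded X"
      using X compact_imp_bounded by auto
  qed (use X(3,4) g sub in blast)+
  then show ?thesis by (rule that)
qed

section \<open>A contracting model of a rotation with several cuts\<close>

text \<open>Rescaling by \<open>1 / M\<close> reduces this to density of the fractional parts of the
  positive multiples of the irrational \<open>\<rho> / M\<close>, applied at the midpoint of the
  interval with half its length as tolerance.\<close>

lemma rotation_dense:
  fixes \<rho> a b :: real and M :: nat
  assumes irr: "\<rho> \<notin> \<rat>" and M: "M \<ge> 1" and ab: "a < b"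
  obtains t :: nat and m :: int where "t \<ge> 1" "a < real t * \<rho> - real M * of_int m"
    "real t * \<rho> - real M * of_int m < b"
proof -
  have "\<rho> / real M \<notin> \<rat>"
  proof
    assume "\<rho> / real M \<in> \<rat>"
    then have "\<rho> / real M * real M \<in> \<rat>" by (intro Rats_mult) auto
    then show False using irr M by simp
  qed
  moreover have "(b - a) / (2 * real M) > 0" using M ab by simp
  ultimately obtain m k :: int where k: "k > 0"
    and *: "\<bar>of_int k * (\<rho> / real M) - of_int m - (a + b) / (2 * real M)\<bar> < (b - a) / (2 * real M)"
    by (rule sequence_of_fractional_parts_is_dense)
  have "of_int k * (\<rho> / real M) - of_int m - (a + b) / (2 * real M)
      = (of_int k * \<rho> - real M * of_int m - (a + b) / 2) / real M"
    using M by (simp add: field_simps)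
  then have "\<bar>of_int k * \<rho> - real M * of_int m - (a + b) / 2\<bar> / real M < (b - a) / 2 / real M"
    using * M by simp
  then have "\<bar>of_int k * \<rho> - real M * of_int m - (a + b) / 2\<bar> < (b - a) / 2"
    using M by (simp only: divide_less_cancel)
  then have "a < of_int k * \<rho> - real M * of_int m" "of_int k * \<rho> - real M * of_int m < b"
    by (simp_all add: abs_less_iff field_simps)
  then show ?thesis
    using k by (intro that[of "nat k" m]) auto
qed

lemma locate_between:
  fixes h :: "nat \<Rightarrow> real"
  assumes "h 0 \<le> r" "r < h n"
  obtains j where "1 \<le> j" "j \<le> n" "h (j - 1) \<le> r" "r < h j"
proof -
  define j where "j = (LEAST j. r < h j)"
  have j: "r < h j" "j \<le> n"
    unfolding j_def using assms(2) by (auto intro: LeastI Least_le)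
  then have "j \<noteq> 0" using assms(1) by (metis not_le)
  then have "\<not> r < h (j - 1)"
    using not_less_Least[of "j - 1" "\<lambda>j. r < h j"] unfolding j_def by fastforce
  then show ?thesis
    using j \<open>j \<noteq> 0\<close> by (intro that[of j]) auto
qed

text \<open>At a point outside \<open>P\<close> both values are limits of \<open>f\<close> along
  \<open>P\<close>, so uniqueness of limits applies.\<close>

lemma continuous_within_extension_eq:
  fixes f g :: "real \<Rightarrow> real"
  assumes f: "continuous (at x within X) f" and "P \<subseteq> X" "x \<in> closure P"
    and g: "continuous_on (closure P) g" and eq: "\<And>y. y \<in> P \<Longrightarrow> g y = f y"
  shows "g x = f x"
proof (cases "x \<in> P")
  case False
  then have nontriv: "at x within P \<noteq> bot"
    using assms(3) by (auto simp: closure_def trivial_limit_within)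
  have "(f \<longlongrightarrow> f x) (at x within P)"
    using f \<open>P \<subseteq> X\<close> by (meson continuous_within tendsto_within_subset)
  moreover have "(g \<longlongrightarrow> g x) (at x within P)"
    using g assms(3) closure_subset by (meson continuous_on_def tendsto_within_subset)
  then have "(f \<longlongrightarrow> g x) (at x within P)"
    by (rule Lim_transform_eventually) (auto simp: eventually_at_filter eq)
  ultimately show ?thesis
    using tendsto_unique[OF nontriv] by blast
qed (simp add: eq)

locale rotation_model =
  fixes \<rho> :: real and M :: nat
  assumes rho: "0 < \<rho>" "\<rho> < 1" and irrational: "\<rho> \<notin> \<rat>" and M: "M \<ge> 1"
begin

lemma int_multiple_rho:
  assumes "real k * \<rho> = of_int a"
  shows "k = 0"
proof (rule ccontr)
  assume "k \<noteq> 0"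
  then have "\<rho> = of_int a / real k" using assms by (simp add: field_simps)
  then show False using irrational by simp
qed

section \<open>The blow-up of the rotation\<close>

text \<open>A weighted sum of step functions that jumps by \<open>(1/2) ^ Suc k\<close> at the
  integer translates of \<open>Suc k * \<rho>\<close>: these are the gaps inserted along the forward
  orbits of the integers. The halving weights produce the slope \<open>1/2\<close>.\<close>

definition jump :: "real \<Rightarrow> real" where
  "jump y = (\<Sum>k. (1/2) ^ Suc k * of_int \<lfloor>y - real (Suc k) * \<rho>\<rfloor>)"

text \<open>The floors grow at most linearly in \<open>k\<close>, so the series is dominated by a
  multiple of the differentiated geometric series at \<open>1/2\<close>.\<close>

lemma summable_jump: "summable (\<lambda>k. (1/2) ^ Suc k * of_int \<lfloor>y - real (Suc k) * \<rho>\<rfloor> :: real)"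
proof (rule summable_comparison_test')
  have "summable (\<lambda>k. real (Suc k) * (1/2) ^ k)"
    using geometric_deriv_sums[of "1/2 :: real"] by (auto simp: sums_iff)
  then show "summable (\<lambda>k. (\<bar>y\<bar> + 2) / 2 * (real (Suc k) * (1/2) ^ k))"
    by (rule summable_mult)
next
  fix k :: nat
  have "0 \<le> real (Suc k) * \<rho>" "real (Suc k) * \<rho> \<le> real (Suc k) * 1"
    using rho by (auto intro!: mult_left_mono)
  moreover have "\<bar>real_of_int \<lfloor>y - r\<rfloor>\<bar> \<le> \<bar>y\<bar> + K + 1" if "0 \<le> r" "r \<le> K" for r K :: real
    using that by linarith
  ultimately have "\<bar>real_of_int \<lfloor>y - real (Suc k) * \<rho>\<rfloor>\<bar> \<le> \<bar>y\<bar> + real (Suc k) + 1"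
    by (metis mult.right_neutral)
  also have "\<dots> \<le> (\<bar>y\<bar> + 2) * real (Suc k)"
    by (simp add: algebra_simps)
  finally have "(1/2) ^ Suc k * \<bar>of_int \<lfloor>y - real (Suc k) * \<rho>\<rfloor>\<bar>
      \<le> (1/2) ^ Suc k * ((\<bar>y\<bar> + 2) * real (Suc k))"
    by (rule mult_left_mono) simp
  then show "norm ((1/2) ^ Suc k * of_int \<lfloor>y - real (Suc k) * \<rho>\<rfloor> :: real)
      \<le> (\<bar>y\<bar> + 2) / 2 * (real (Suc k) * (1/2) ^ k)"
    by (simp add: abs_mult mult_ac)
qed

text \<open>Moving by \<rho> shifts the index of the series by one: every old term is halved, and a
  new first term comes from the floor of \<open>y\<close>.\<close>

lemma jump_add_rho: "jump (y + \<rho>) = jump y / 2 + of_int \<lfloor>y\<rfloor> / 2"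
proof -
  let ?T = "\<lambda>y k. (1/2) ^ Suc k * of_int \<lfloor>y - real (Suc k) * \<rho>\<rfloor> :: real"
  have "?T (y + \<rho>) (Suc k) = 1/2 * ?T y k" for k
    by (simp add: algebra_simps)
  then have "(\<Sum>k. ?T (y + \<rho>) (Suc k)) = 1/2 * jump y"
    unfolding jump_def by (simp only: suminf_mult[OF summable_jump])
  moreover have "(\<Sum>k. ?T (y + \<rho>) (Suc k)) = jump (y + \<rho>) - ?T (y + \<rho>) 0"
    unfolding jump_def by (rule suminf_split_head[OF summable_jump])
  ultimately show ?thesis by simp
qed

text \<open>Every floor grows by \<open>m\<close>, and the weights sum to 1.\<close>

lemma jump_add_int: "jump (y + of_int m) = jump y + of_int m"
proof -
  have "(\<lambda>k. (1/2) ^ Suc k * of_int \<lfloor>y - real (Suc k) * \<rho>\<rfloor> + of_int m * (1/2) ^ Suc k)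
      sums (jump y + of_int m * 1)"
    unfolding jump_def
    by (intro sums_add summable_sums[OF summable_jump] sums_mult power_half_series)
  moreover have "(1/2) ^ Suc k * of_int \<lfloor>y - real (Suc k) * \<rho>\<rfloor> + of_int m * (1/2) ^ Suc k
      = ((1/2) ^ Suc k * of_int \<lfloor>y + of_int m - real (Suc k) * \<rho>\<rfloor> :: real)" for k
  proof -
    have "y + of_int m - real (Suc k) * \<rho> = (y - real (Suc k) * \<rho>) + of_int m" by simp
    then have "\<lfloor>y + of_int m - real (Suc k) * \<rho>\<rfloor> = \<lfloor>y - real (Suc k) * \<rho>\<rfloor> + m"
      by (metis floor_add_int)
    then show ?thesis by (simp add: algebra_simps)
  qed
  ultimately have "(\<lambda>k. (1/2) ^ Suc k * of_int \<lfloor>y + of_int m - real (Suc k) * \<rho>\<rfloor>)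
      sums (jump y + of_int m * 1)"
    by (simp only:)
  then show ?thesis
    unfolding jump_def[of "y + of_int m"] by (simp only: sums_iff mult_1_right)
qed

text \<open>All terms are monotone, and density of the rotation orbit modulo 1 places a jump of some
  term strictly between \<open>y\<close> and \<open>z\<close>.\<close>

lemma jump_strict_mono:
  assumes "y < z"
  shows "jump y < jump z"
proof -
  let ?T = "\<lambda>y k. (1/2) ^ Suc k * of_int \<lfloor>y - real (Suc k) * \<rho>\<rfloor> :: real"
  obtain t and m :: int where t: "t \<ge> 1" "y < real t * \<rho> - real 1 * of_int m"
      "real t * \<rho> - real 1 * of_int m < z"
    using rotation_dense[OF irrational _ assms, of 1] by auto
  then obtain k where k: "t = Suc k" by (cases t) auto
  have "\<lfloor>y - real (Suc k) * \<rho>\<rfloor> < - m" "- m \<le> \<lfloor>z - real (Suc k) * \<rho>\<rfloor>"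
    using t unfolding k by (simp_all add: floor_less_iff le_floor_iff)
  then have "?T y k < ?T z k" by simp
  moreover have "?T y j \<le> ?T z j" for j
    using assms by (intro mult_left_mono) (auto intro: floor_mono)
  ultimately have "0 < (\<Sum>k. ?T z k - ?T y k)"
    by (intro suminf_pos2[where i = k] summable_diff summable_jump) auto
  then show ?thesis
    unfolding jump_def by (simp only: suminf_diff[OF summable_jump summable_jump, symmetric])
qed

text \<open>\<open>phi\<close> conjugates the translation by \<open>\<rho>\<close> to the contraction \<open>lift\<close> of slope \<open>1/2\<close> with jumps
  at the integers; it is obtained by solving \<open>phi (y + \<rho>) = phi y / 2 + \<lfloor>y\<rfloor> / 2 + \<mu>\<close> by iteration, with
  \<open>\<mu>\<close> chosen such that \<open>phi 0 = 0\<close>.\<close>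
definition phi :: "real \<Rightarrow> real" where "phi y = jump y - jump 0"

definition \<mu> :: real where "\<mu> = - jump 0 / 2"

definition lift :: "real \<Rightarrow> real" where "lift x = x / 2 + of_int \<lfloor>x\<rfloor> / 2 + \<mu>"

lemma phi_strict_mono: "y < z \<Longrightarrow> phi y < phi z"
  by (simp add: phi_def jump_strict_mono)

lemma phi_mono: "y \<le> z \<Longrightarrow> phi y \<le> phi z"
  using phi_strict_mono by (fastforce simp: le_less)

lemma phi_less_iff: "phi y < phi z \<longleftrightarrow> y < z"
  using phi_strict_mono phi_mono by (meson not_le)

lemma phi_add_int: "phi (y + of_int m) = phi y + of_int m"
  by (simp add: phi_def jump_add_int)

lemma phi_int: "phi (of_int m) = of_int m"
  using phi_add_int[of 0 m] by (simp add: phi_def)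

lemma phi_nat: "phi (real n) = real n"
  using phi_int[of "int n"] by simp

lemma phi_0: "phi 0 = 0"
  using phi_nat[of 0] by simp

lemma floor_phi: "\<lfloor>phi y\<rfloor> = \<lfloor>y\<rfloor>"
proof (rule floor_unique)
  show "of_int \<lfloor>y\<rfloor> \<le> phi y"
    using phi_mono[of "of_int \<lfloor>y\<rfloor>" y] by (simp add: phi_int)
  show "phi y < of_int \<lfloor>y\<rfloor> + 1"
    using phi_strict_mono[of y "of_int (\<lfloor>y\<rfloor> + 1)"] unfolding phi_int by simp
qed

text \<open>Since \<open>phi\<close> preserves integer parts, this is the functional equation of
  \<open>jump\<close>, with \<open>\<mu>\<close> absorbing the constants
  \<open>jump 0\<close>.\<close>

lemma lift_phi: "lift (phi y) = phi (y + \<rho>)"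
  unfolding lift_def floor_phi unfolding phi_def \<mu>_def jump_add_rho by (simp add: field_simps)

lemma lift_strict_mono: "x < y \<Longrightarrow> lift x < lift y"
  using floor_mono[of x y] by (simp add: lift_def)

lemma lift_mono: "x \<le> y \<Longrightarrow> lift x \<le> lift y"
  using lift_strict_mono by (fastforce simp: le_less)

lemma lift_add_int: "lift (x + of_int m) = lift x + of_int m"
  by (simp add: lift_def field_simps)

lemma mu_eq: "\<mu> = phi \<rho>"
  using lift_phi[of 0] by (simp add: phi_0 lift_def)

lemma mu: "0 < \<mu>" "\<mu> < 1"
  using phi_strict_mono[OF rho(1)] phi_strict_mono[OF rho(2)] phi_0 phi_nat[of 1]
  by (simp_all add: mu_eq)

section \<open>Cuts, pieces and the circle map\<close>

text \<open>Cuts are given in the angle coordinate of the rotation and carried over by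
  \<open>phi\<close>. Indices above \<open>M\<close> give the right end, which is the point 0 again
  on the circle.\<close>

definition cut_pt :: "nat \<Rightarrow> real" where
  "cut_pt i = (if i < M then real i else if i = M then real M - \<rho> else real M)"

definition piece :: "nat \<Rightarrow> real set" where
  "piece i = {phi (cut_pt (i - 1))<..<phi (cut_pt i)}"

definition rmap :: "real \<Rightarrow> real" where
  "rmap x = (if lift x < real M then lift x else lift x - real M)"

text \<open>The integer part is \<open>i - 1\<close> on the pieces up to \<open>M\<close>, and
  \<open>M - 1\<close> on the last one, where \<open>lift\<close> exceeds \<open>M\<close> and the
  circle map wraps around.\<close>

definition branch :: "nat \<Rightarrow> real \<Rightarrow> real" where
  "branch i y = y / 2 + (if i \<le> M then (real i - 1) / 2 + \<mu> else (real M - 1) / 2 + \<mu> - real M)"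

lemma cut_0: "cut_pt 0 = 0" and cut_top: "cut_pt (Suc M) = real M" and cut_M: "cut_pt M = real M - \<rho>"
  using M by (auto simp: cut_pt_def)

lemma cut_strict_mono:
  assumes "i < j" "j \<le> Suc M"
  shows "cut_pt i < cut_pt j"
proof -
  have "i < M \<Longrightarrow> real i + 1 \<le> real M" by linarith
  then show ?thesis using assms rho by (auto simp: cut_pt_def)
qed

lemma cut_mono: "i \<le> j \<Longrightarrow> j \<le> Suc M \<Longrightarrow> cut_pt i \<le> cut_pt j"
  using cut_strict_mono by (fastforce simp: le_less)

lemma phi_cut_strict_mono: "i < j \<Longrightarrow> j \<le> Suc M \<Longrightarrow> phi (cut_pt i) < phi (cut_pt j)"
  by (simp add: phi_strict_mono cut_strict_mono)

lemma phi_cut_mono: "i \<le> j \<Longrightarrow> j \<le> Suc M \<Longrightarrow> phi (cut_pt i) \<le> phi (cut_pt j)"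
  by (simp add: phi_mono cut_mono)

lemma phi_cut_nat: "i < M \<Longrightarrow> phi (cut_pt i) = real i"
  by (simp add: cut_pt_def phi_nat)

lemma closure_piece:
  "i \<in> {1..Suc M} \<Longrightarrow> closure (piece i) = {phi (cut_pt (i - 1))..phi (cut_pt i)}"
  unfolding piece_def by (rule closure_greaterThanLessThan) (simp add: phi_cut_strict_mono)

lemma piece_unique:
  assumes "i \<in> {1..Suc M}" "j \<in> {1..Suc M}" "x \<in> piece i" "x \<in> closure (piece j)"
  shows "i = j"
proof (rule ccontr)
  assume "i \<noteq> j"
  then consider "i \<le> j - 1" | "j \<le> i - 1" by linarith
  then show False
  proof cases
    case 1
    then have "phi (cut_pt i) \<le> phi (cut_pt (j - 1))" using assms by (intro phi_cut_mono) auto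
    then show False using assms unfolding closure_piece[OF assms(2)] by (auto simp: piece_def)
  next
    case 2
    then have "phi (cut_pt j) \<le> phi (cut_pt (i - 1))" using assms by (intro phi_cut_mono) auto
    then show False using assms unfolding closure_piece[OF assms(2)] by (auto simp: piece_def)
  qed
qed

lemma piece_subset_interval:
  assumes "i \<in> {1..Suc M}"
  shows "piece i \<subseteq> {0<..<real M}" "closure (piece i) \<subseteq> {0..real M}"
proof -
  have "0 \<le> phi (cut_pt (i - 1))" "phi (cut_pt i) \<le> real M"
    using phi_cut_mono[of 0 "i - 1"] phi_cut_mono[of i "Suc M"] assms
    by (auto simp: cut_0 cut_top phi_0 phi_nat)
  then show "piece i \<subseteq> {0<..<real M}" "closure (piece i) \<subseteq> {0..real M}"
    using closure_piece[OF assms] by (auto simp: piece_def)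
qed

lemma rmap_piece:
  assumes i: "i \<in> {1..Suc M}" and y: "y \<in> piece i"
  shows "rmap y = branch i y"
proof -
  \<comment> \<open>The last interior cut is exactly where \<open>lift\<close> reaches
    \<open>M\<close>, so \<open>rmap\<close> wraps to its right only.\<close>
  have lift_M: "lift (phi (cut_pt M)) = real M"
    by (simp add: cut_M lift_phi phi_nat)
  show ?thesis
  proof (cases "i \<le> M")
    case True
    have "phi (cut_pt (i - 1)) = real (i - 1)" using True i by (intro phi_cut_nat) auto
    moreover have "phi (cut_pt i) \<le> phi (real i)"
      using True rho by (intro phi_mono) (auto simp: cut_pt_def)
    ultimately have "\<lfloor>y\<rfloor> = int i - 1"
      using y i by (intro floor_unique) (auto simp: piece_def phi_nat)
    moreover have "y < phi (cut_pt M)"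
      using y phi_cut_mono[of i M] True by (simp add: piece_def)
    then have "lift y < real M"
      using lift_strict_mono lift_M by metis
    ultimately show ?thesis
      using True by (simp add: rmap_def branch_def lift_def)
  next
    case False
    then have [simp]: "i = Suc M" using i by simp
    have "phi (real (M - 1)) \<le> phi (cut_pt M)"
      using M rho by (intro phi_mono) (simp add: cut_M of_nat_diff)
    then have "\<lfloor>y\<rfloor> = int M - 1"
      using y M unfolding phi_nat
      by (intro floor_unique) (auto simp: piece_def phi_nat cut_top of_nat_diff)
    moreover have "phi (cut_pt M) < y" using y by (simp add: piece_def)
    then have "real M < lift y" using lift_strict_mono lift_M by metis
    ultimately show ?thesis
      by (simp add: rmap_def branch_def lift_def)
  qed
qed

text \<open>The images of the first \<open>M\<close> pieces follow each other with gaps of at least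
  \<open>1/2\<close>. The last piece wraps around: its image stays at or below
  \<open>\<mu> - 1/2\<close>, while all the others stay at or above \<open>\<mu>\<close>.\<close>

lemma branch_disjoint_less:
  assumes ij: "i \<in> {1..Suc M}" "j \<in> {1..Suc M}" "i < j"
    and "a \<in> closure (piece i)" "b \<in> closure (piece j)"
  shows "branch i a \<noteq> branch j b"
proof (cases "j \<le> M")
  case True
  have "a \<le> real i" "real j - 1 \<le> b"
    using assms True phi_cut_nat[of i] phi_cut_nat[of "j - 1"] by (auto simp: closure_piece of_nat_diff)
  moreover have "real i + 1 \<le> real j" using ij by linarith
  ultimately have "branch i a < branch j b"
    using True ij by (simp add: branch_def field_simps)
  then show ?thesis by simp
next
  case False
  then have "real i - 1 \<le> a" "b \<le> real M" "1 \<le> real i" "i \<le> M"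
    using assms phi_cut_nat[of "i - 1"] piece_subset_interval[of j]
    by (auto simp: closure_piece of_nat_diff)
  then have "branch j b < branch i a"
    using False by (simp add: branch_def field_simps)
  then show ?thesis by simp
qed

lemma branch_disjoint:
  assumes "i \<in> {1..Suc M}" "j \<in> {1..Suc M}" "i \<noteq> j"
  shows "branch i ` closure (piece i) \<inter> branch j ` closure (piece j) = {}"
proof -
  have "branch i a \<noteq> branch j b" if "a \<in> closure (piece i)" "b \<in> closure (piece j)" for a b
    using branch_disjoint_less[of i j a b] branch_disjoint_less[of j i b a] assms that
    by (metis neq_iff)
  then show ?thesis by blast
qed

section \<open>Separation and piecewise contraction\<close>

lemma continuous_branch: "continuous_on S (branch i)"
  unfolding branch_def by (intro continuous_intros) auto

lemma rmap_separation: "separation_property (Suc M) piece rmap"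
  unfolding separation_property_def
proof (intro exI[of _ branch] conjI ballI impI)
  show "inj_on (branch i) (closure (piece i))" for i
    by (auto simp: inj_on_def branch_def)
qed (use branch_disjoint rmap_piece continuous_branch in auto)

lemma piece_disc_set:
  assumes "i \<in> {1..Suc M}" "x \<in> piece i"
  shows "x \<notin> disc_set (Suc M) piece"
  using assms piece_unique unfolding disc_set_def by blast

text \<open>Continuity at a common border point would force the two adjacent branches to agree
  there, against the disjointness of their images.\<close>

lemma rmap_discontinuous:
  assumes "x \<in> disc_set (Suc M) piece"
  shows "\<not> continuous (at x within {0..real M}) rmap"
proof
  assume cont: "continuous (at x within {0..real M}) rmap"
  obtain i j where ij: "i \<in> {1..Suc M}" "j \<in> {1..Suc M}" "i \<noteq> j"
      "x \<in> closure (piece i)" "x \<in> closure (piece j)"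
    using assms unfolding disc_set_def by blast
  have "branch k x = rmap x" if k: "k \<in> {1..Suc M}" "x \<in> closure (piece k)" for k
  proof (rule continuous_within_extension_eq[OF cont _ k(2) continuous_branch])
    show "piece k \<subseteq> {0..real M}"
      using piece_subset_interval[OF k(1)] by fastforce
  qed (simp add: rmap_piece[OF k(1)])
  then have "branch i x = branch j x" using ij by simp
  then show False using branch_disjoint[OF ij(1-3)] ij(4,5) by blast
qed

lemma rmap_piecewise_contracting:
  "piecewise_contracting_interval_map {0..real M} (Suc M) piece rmap"
  unfolding piecewise_contracting_interval_map_def
proof (intro conjI ballI impI)
  show "Suc M \<ge> 2" "compact {0..real M}" "is_interval {0..real M}" "{0..real M} \<noteq> {}"
    using M by (auto simp: is_interval_cc)
  show "piece i \<noteq> {}" "is_interval (piece i)" "openin (top_of_set {0..real M}) (piece i)"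
    if "i \<in> {1..Suc M}" for i
  proof -
    show "piece i \<noteq> {}" using phi_cut_strict_mono[of "i - 1" i] that by (simp add: piece_def)
    show "is_interval (piece i)" by (simp add: piece_def is_interval_oo)
    show "openin (top_of_set {0..real M}) (piece i)"
      using piece_subset_interval[OF that]
      by (intro open_subset) (auto simp: piece_def)
  qed
  show "piece i \<inter> piece j = {}" if "i \<in> {1..Suc M}" "j \<in> {1..Suc M}" "i \<noteq> j" for i j
    using piece_unique[OF that(1,2)] that(3) closure_subset by blast
  show "{0..real M} = (\<Union>i\<in>{1..Suc M}. closure (piece i))"
  proof
    show "(\<Union>i\<in>{1..Suc M}. closure (piece i)) \<subseteq> {0..real M}"
      using piece_subset_interval by blast
    show "{0..real M} \<subseteq> (\<Union>i\<in>{1..Suc M}. closure (piece i))"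
    proof
      fix x assume x: "x \<in> {0..real M}"
      \<comment> \<open>The right end is treated apart, because the search for the next cut needs
        \<open>x\<close> strictly below the last one.\<close>
      show "x \<in> (\<Union>i\<in>{1..Suc M}. closure (piece i))"
      proof (cases "x = real M")
        case True
        then have "x \<in> closure (piece (Suc M))"
          using phi_cut_strict_mono[of M "Suc M"] by (simp add: closure_piece cut_top phi_nat)
        then show ?thesis by auto
      next
        case False
        then obtain j where "1 \<le> j" "j \<le> Suc M" "phi (cut_pt (j - 1)) \<le> x" "x < phi (cut_pt j)"
          using locate_between[of "\<lambda>j. phi (cut_pt j)" x "Suc M"] x
          by (auto simp: cut_0 cut_top phi_0 phi_nat)
        then have "x \<in> closure (piece j)" "j \<in> {1..Suc M}"
          by (auto simp: closure_piece)
        then show ?thesis by blast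
      qed
    qed
  qed
  show "rmap ` {0..real M} \<subseteq> {0..real M}"
  proof
    fix y assume "y \<in> rmap ` {0..real M}"
    then obtain x where x: "0 \<le> x" "x \<le> real M" "y = rmap x" by auto
    \<comment> \<open>Values of \<open>lift\<close> exceed \<open>M\<close> by at most
      \<open>\<mu> < 1 \<le> M\<close>, so a single subtraction of \<open>M\<close> returns them to
      the interval.\<close>
    have "lift 0 \<le> lift x" "lift x \<le> lift (real M)" using x by (auto intro: lift_mono)
    then have "0 \<le> lift x" "lift x \<le> real M + \<mu>" using mu by (auto simp: lift_def)
    moreover have "1 \<le> real M" using M by simp
    ultimately show "y \<in> {0..real M}" using mu x(3) by (auto simp: rmap_def)
  qed
  show "\<not> continuous (at x within {0..real M}) rmap" if "x \<in> disc_set (Suc M) piece" for x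
    by (rule rmap_discontinuous[OF that])
  show "\<exists>lam. 0 < lam \<and> lam < 1 \<and>
      (\<forall>i\<in>{1..Suc M}. \<forall>x\<in>piece i. \<forall>y\<in>piece i. dist (rmap x) (rmap y) \<le> lam * dist x y)"
  proof (intro exI[of _ "1/2"] conjI ballI)
    fix i x y assume i: "i \<in> {1..Suc M}" and xy: "x \<in> piece i" "y \<in> piece i"
    have "rmap x - rmap y = (x - y) / 2"
      by (simp add: rmap_piece[OF i xy(1)] rmap_piece[OF i xy(2)] branch_def diff_divide_distrib)
    then show "dist (rmap x) (rmap y) \<le> 1/2 * dist x y"
      unfolding dist_real_def by (simp only: abs_divide)
  qed auto
qed

lemma rmap_affine: "\<forall>i\<in>{1..Suc M}. \<exists>c d. \<forall>y\<in>piece i. rmap y = c * y + d"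
proof
  fix i assume i: "i \<in> {1..Suc M}"
  show "\<exists>c d. \<forall>y\<in>piece i. rmap y = c * y + d"
    by (rule exI[of _ "1/2"], rule exI[of _ "branch i 0"]) (simp add: rmap_piece[OF i] branch_def)
qed

section \<open>Rotation orbits and the cuts\<close>

lemma locate_mod:
  assumes "\<And>j m. j \<le> M \<Longrightarrow> z \<noteq> cut_pt j + real M * of_int m"
  obtains j and m :: int where "j \<in> {1..Suc M}" "cut_pt (j - 1) < z - real M * of_int m"
    "z - real M * of_int m < cut_pt j"
proof -
  define m where "m = \<lfloor>z / real M\<rfloor>"
  have "of_int m \<le> z / real M" "z / real M < of_int m + 1"
    unfolding m_def by linarith+
  then have "0 \<le> z - real M * of_int m" "z - real M * of_int m < real M"
    using M by (simp_all add: field_simps)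
  then obtain j where j: "1 \<le> j" "j \<le> Suc M" "cut_pt (j - 1) \<le> z - real M * of_int m"
      "z - real M * of_int m < cut_pt j"
    using locate_between[of cut_pt "z - real M * of_int m" "Suc M"] by (auto simp: cut_0 cut_top)
  moreover have "z - real M * of_int m \<noteq> cut_pt (j - 1)"
    using assms[of "j - 1" m] j by (auto simp: algebra_simps)
  ultimately show ?thesis by (intro that[of j m]) auto
qed

lemma cut_cases:
  assumes "j \<le> M"
  obtains "j < M" "cut_pt j = real j" | "j = M" "cut_pt j = real M - \<rho>"
  using assms by (cases "j < M") (auto simp: cut_pt_def)

text \<open>The only coincidence between backward orbits of cuts would be the preimage \<open>M - \<rho>\<close> of \<open>0\<close>, and
  \<open>0\<close> is not an interior cut.\<close>
lemma cut_backward_orbit: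
  assumes i: "i \<in> {1..M}" and k: "k \<ge> 1" and j: "j \<le> M"
  shows "cut_pt i - real k * \<rho> \<noteq> cut_pt j + real M * of_int m"
proof
  assume eq: "cut_pt i - real k * \<rho> = cut_pt j + real M * of_int m"
  have "i \<le> M" using i by simp
  then show False
  proof (cases i rule: cut_cases)
    case 1
    show False
      using j
    proof (cases j rule: cut_cases)
      case 1
      then have "real k * \<rho> = of_int (int i - int j - int M * m)"
        using eq \<open>cut_pt i = real i\<close> by simp
      then show False using int_multiple_rho k by fastforce
    next
      case 2
      have "real (k - 1) * \<rho> = of_int (int i - int M - int M * m)"
        using eq 1 2 k by (simp add: of_nat_diff algebra_simps)
      then have "k - 1 = 0" and "of_int (int i - int M - int M * m) = (0::real)"
        using int_multiple_rho by fastforce+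
      then have "int i = int M * (1 + m)"
        by (simp only: of_int_eq_0_iff) (simp add: algebra_simps)
      then have "M dvd i"
        by (metis dvd_triv_left int_dvd_int_iff)
      then show False using i 1 by (auto dest: dvd_imp_le)
    qed
  next
    case 2
    show False
      using j
    proof (cases j rule: cut_cases)
      case 1
      then have "real (k + 1) * \<rho> = of_int (int M - int j - int M * m)"
        using eq 2 by (simp add: algebra_simps)
      then show False using int_multiple_rho by fastforce
    next
      case last: 2
      then have "real k * \<rho> = of_int (- int M * m)"
        using eq 2 by (simp add: algebra_simps)
      then show False using int_multiple_rho k by fastforce
    qed
  qed
qed

text \<open>A hit would make \<open>k * \<rho>\<close> or \<open>(k + 1) * \<rho>\<close> an
  integer; \<open>k \<ge> 1\<close> leaves out the starting point 0, itself a cut.\<close>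

lemma rotation_orbit_not_cut:
  assumes k: "k \<ge> 1" and j: "j \<le> M"
  shows "real k * \<rho> \<noteq> cut_pt j + real M * of_int m"
proof
  assume eq: "real k * \<rho> = cut_pt j + real M * of_int m"
  show False
    using j
  proof (cases j rule: cut_cases)
    case 1
    then have "real k * \<rho> = of_int (int j + int M * m)" using eq by simp
    then show False using int_multiple_rho k by fastforce
  next
    case 2
    then have "real (k + 1) * \<rho> = of_int (int M + int M * m)"
      using eq by (simp add: algebra_simps)
    then show False using int_multiple_rho by fastforce
  qed
qed

section \<open>An orbit that avoids the cuts\<close>

text \<open>Because \<open>\<mu> = phi \<rho>\<close>, the orbit of \<open>\<mu>\<close> is the
  \<open>phi\<close>-image of the rotation orbit of \<rho>, whence the index \<open>Suc t\<close>.
  As \<open>phi\<close> is strictly increasing and fixes \<open>M\<close>, the map wraps exactly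
  when the rotation does.\<close>

lemma rmap_orbit_phi:
  "\<exists>m::int. 0 \<le> real (Suc t) * \<rho> - real M * of_int m \<and> real (Suc t) * \<rho> - real M * of_int m < real M \<and>
    (rmap ^^ t) \<mu> = phi (real (Suc t) * \<rho> - real M * of_int m)"
proof (induction t)
  case 0
  then show ?case
    using rho M by (intro exI[of _ 0]) (auto simp: mu_eq)
next
  case (Suc t)
  then obtain m :: int where m: "0 \<le> real (Suc t) * \<rho> - real M * of_int m"
      "real (Suc t) * \<rho> - real M * of_int m < real M"
      "(rmap ^^ t) \<mu> = phi (real (Suc t) * \<rho> - real M * of_int m)" by blast
  define y where "y = real (Suc t) * \<rho> - real M * of_int m"
  have next_eq: "real (Suc (Suc t)) * \<rho> - real M * of_int m = y + \<rho>"
    "real (Suc (Suc t)) * \<rho> - real M * of_int (m + 1) = y + \<rho> - real M"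
    by (simp_all add: y_def algebra_simps)
  have "(rmap ^^ Suc t) \<mu> = rmap (phi y)" using m(3) by (simp add: y_def)
  then have orb: "(rmap ^^ Suc t) \<mu> =
      (if phi (y + \<rho>) < phi (real M) then phi (y + \<rho>) else phi (y + \<rho>) - real M)"
    by (simp add: rmap_def lift_phi phi_nat)
  show ?case
  proof (cases "y + \<rho> < real M")
    case True
    then show ?thesis
      using m(1) rho orb unfolding y_def[symmetric]
      by (intro exI[of _ m]) (simp only: next_eq phi_less_iff if_True, simp)
  next
    case False
    have "phi (y + \<rho>) - real M = phi (y + \<rho> - real M)"
      using phi_add_int[of "y + \<rho> - real M" "int M"] by simp
    moreover have "1 \<le> real M" using M by simp
    ultimately show ?thesis
      using m(2) rho orb False unfolding y_def[symmetric]
      by (intro exI[of _ "m + 1"]) (simp only: next_eq phi_less_iff if_False, simp)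
  qed
qed

lemma rmap_orbit_in_piece: "\<exists>i\<in>{1..Suc M}. (rmap ^^ t) \<mu> \<in> piece i"
proof -
  obtain m :: int where m: "0 \<le> real (Suc t) * \<rho> - real M * of_int m"
      "real (Suc t) * \<rho> - real M * of_int m < real M"
      "(rmap ^^ t) \<mu> = phi (real (Suc t) * \<rho> - real M * of_int m)"
    using rmap_orbit_phi by blast
  define y where "y = real (Suc t) * \<rho> - real M * of_int m"
  obtain j where j: "1 \<le> j" "j \<le> Suc M" "cut_pt (j - 1) \<le> y" "y < cut_pt j"
    using locate_between[of cut_pt y "Suc M"] m by (auto simp: cut_0 cut_top y_def)
  moreover have "y \<noteq> cut_pt (j - 1)"
    using rotation_orbit_not_cut[of "Suc t" "j - 1" m] j by (auto simp: y_def algebra_simps)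
  ultimately show ?thesis
    using m(3) unfolding y_def[symmetric]
    by (intro bexI[of _ j]) (auto simp: piece_def phi_less_iff)
qed

text \<open>Keeps the claim about all itineraries from being vacuous: the orbit of
  \<open>\<mu>\<close> stays inside the open pieces.\<close>

lemma itinerary_exists:
  "\<exists>x \<theta>. x \<in> Xtilde {0..real M} (Suc M) piece rmap \<and> is_itinerary (Suc M) piece rmap x \<theta>"
proof -
  define \<theta> where "\<theta> t = (SOME i. i \<in> {1..Suc M} \<and> (rmap ^^ t) \<mu> \<in> piece i)" for t
  have \<theta>: "\<theta> t \<in> {1..Suc M}" "(rmap ^^ t) \<mu> \<in> piece (\<theta> t)" for t
    using rmap_orbit_in_piece[of t] someI_ex[of "\<lambda>i. i \<in> {1..Suc M} \<and> (rmap ^^ t) \<mu> \<in> piece i"]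
    unfolding \<theta>_def by blast+
  have "(rmap ^^ t) \<mu> \<in> {0..real M} - disc_set (Suc M) piece" for t
    using piece_disc_set[OF \<theta>] piece_subset_interval[OF \<theta>(1)[of t]] \<theta>(2)[of t] by fastforce
  moreover from this[of 0] have "\<mu> \<in> {0..real M}" by simp
  ultimately have "\<mu> \<in> Xtilde {0..real M} (Suc M) piece rmap"
    by (auto simp: Xtilde_def)
  then show ?thesis using \<theta> by (auto simp: is_itinerary_def)
qed

section \<open>Reading letters from angles\<close>

text \<open>One step of \<open>rmap\<close> subtracts \<open>M\<close> at most once, and
  \<open>lift\<close> commutes with integer translations, so the discrepancy remains a multiple of
  \<open>M\<close>.\<close>

lemma rmap_lift_orbit: "\<exists>m::int. (lift ^^ t) x = (rmap ^^ t) x + real M * of_int m"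
proof (induction t)
  case 0
  then show ?case by (intro exI[of _ 0]) simp
next
  case (Suc t)
  then obtain m :: int where m: "(lift ^^ t) x = (rmap ^^ t) x + real M * of_int m" by blast
  have "lift ((lift ^^ t) x) = lift ((rmap ^^ t) x) + real M * of_int m"
    using lift_add_int[of "(rmap ^^ t) x" "int M * m"] m by simp
  moreover have "lift ((rmap ^^ t) x) = rmap ((rmap ^^ t) x) \<or>
      lift ((rmap ^^ t) x) = rmap ((rmap ^^ t) x) + real M"
    unfolding rmap_def[of "(rmap ^^ t) x"] by simp
  ultimately have "lift ((lift ^^ t) x) = rmap ((rmap ^^ t) x) + real M * of_int m \<or>
      lift ((lift ^^ t) x) = rmap ((rmap ^^ t) x) + real M * of_int (m + 1)"
    by (auto simp: algebra_simps)
  then show ?case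
    unfolding funpow.simps comp_apply by blast
qed

text \<open>The angle of \<open>x\<close> is its image under the monotone semiconjugacy inverse to \<open>phi\<close>.\<close>
lemma angle_exists:
  obtains y0 where "\<And>t y. y < y0 + real t * \<rho> \<Longrightarrow> phi y \<le> (lift ^^ t) x"
    "\<And>t y. y > y0 + real t * \<rho> \<Longrightarrow> (lift ^^ t) x < phi y"
proof -
  define S where "S = {y. phi y \<le> x}"
  have down: "z \<in> S" if "y \<in> S" "z \<le> y" for y z
    using that phi_mono[of z y] by (simp add: S_def)
  have "of_int \<lfloor>x\<rfloor> \<in> S" by (simp add: S_def phi_int)
  then have ne: "S \<noteq> {}" by blast
  have "x < phi (of_int (\<lfloor>x\<rfloor> + 1))" unfolding phi_int by linarith
  then have "of_int (\<lfloor>x\<rfloor> + 1) \<notin> S" unfolding S_def by simp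
  then have "\<forall>y\<in>S. y \<le> of_int (\<lfloor>x\<rfloor> + 1)" using down by (meson linear)
  then have bdd: "bdd_above S" by (meson bdd_above.I)
  have low: "phi y \<le> x" if "y < Sup S" for y
    using less_cSupD[OF ne that] down[of _ y] by (auto simp: S_def less_imp_le)
  have high: "x < phi y" if "y > Sup S" for y
    using cSup_upper[OF _ bdd, of y] that by (force simp: S_def)
  \<comment> \<open>Both inequalities propagate through the conjugacy \<open>lift_phi\<close>;
    nothing is claimed at the angle itself, where \<open>phi\<close> may jump across the orbit
    point.\<close>
  have "(\<forall>y < Sup S + real t * \<rho>. phi y \<le> (lift ^^ t) x) \<and>
        (\<forall>y > Sup S + real t * \<rho>. (lift ^^ t) x < phi y)" for t
  proof (induction t)
    case (Suc t)
    have step: "phi y = lift (phi (y - \<rho>))" for y by (simp add: lift_phi)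
    show ?case
    proof (intro conjI allI impI)
      fix y assume "y < Sup S + real (Suc t) * \<rho>"
      then have "phi (y - \<rho>) \<le> (lift ^^ t) x" using Suc by (simp add: algebra_simps)
      then show "phi y \<le> (lift ^^ Suc t) x" using lift_mono by (simp add: step[of y])
    next
      fix y assume "y > Sup S + real (Suc t) * \<rho>"
      then have "(lift ^^ t) x < phi (y - \<rho>)" using Suc by (simp add: algebra_simps)
      then show "(lift ^^ Suc t) x < phi y" using lift_strict_mono by (simp add: step[of y])
    qed
  qed (use low high in auto)
  then show ?thesis by (intro that[of "Sup S"]) blast+
qed

text \<open>The angle traps the orbit point, up to a multiple of \<open>M\<close>, between the
  images of two consecutive cuts. Both lie in the same turn of the circle, so the multiple vanishes,
  and a point of an open piece lies in no other closed piece.\<close>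

lemma letter_of_angle:
  assumes it: "is_itinerary (Suc M) piece rmap x \<theta>"
    and low: "\<And>t y. y < y0 + real t * \<rho> \<Longrightarrow> phi y \<le> (lift ^^ t) x"
    and high: "\<And>t y. y > y0 + real t * \<rho> \<Longrightarrow> (lift ^^ t) x < phi y"
    and i: "i \<in> {1..Suc M}" and m: "cut_pt (i - 1) < y0 + real t * \<rho> - real M * of_int m"
      "y0 + real t * \<rho> - real M * of_int m < cut_pt i"
  shows "\<theta> t = i"
proof -
  have \<theta>: "\<theta> t \<in> {1..Suc M}" "(rmap ^^ t) x \<in> piece (\<theta> t)"
    using it by (auto simp: is_itinerary_def)
  then have x: "0 < (rmap ^^ t) x" "(rmap ^^ t) x < real M"
    using piece_subset_interval(1)[OF \<theta>(1)] by auto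
  obtain m' :: int where m': "(lift ^^ t) x = (rmap ^^ t) x + real M * of_int m'"
    using rmap_lift_orbit by blast
  have shift: "phi (y + real M * of_int m) = phi y + real M * of_int m" for y
    using phi_add_int[of y "int M * m"] by simp
  have "phi (cut_pt (i - 1)) + real M * of_int m \<le> (lift ^^ t) x"
    unfolding shift[symmetric] using m by (intro low) simp
  moreover have "(lift ^^ t) x < phi (cut_pt i) + real M * of_int m"
    unfolding shift[symmetric] using m by (intro high) simp
  ultimately have b: "phi (cut_pt (i - 1)) \<le> (rmap ^^ t) x + real M * (of_int m' - of_int m)"
    "(rmap ^^ t) x + real M * (of_int m' - of_int m) < phi (cut_pt i)"
    unfolding m' by (simp_all add: algebra_simps)
  have "0 \<le> phi (cut_pt (i - 1))" "phi (cut_pt i) \<le> real M"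
    using phi_cut_mono[of 0 "i - 1"] phi_cut_mono[of i "Suc M"] i
    by (auto simp: cut_0 cut_top phi_0 phi_nat)
  then have "real M * (of_int m' - of_int m) < real M * 1"
    "real M * (-1) < real M * (of_int m' - of_int m)"
    using b x by linarith+
  then have "of_int m' - of_int m < (1::real)" "-1 < of_int m' - (of_int m :: real)"
    using M by (simp_all only: mult_less_cancel_left_pos of_nat_0_less_iff)
  then have "m' = m" by linarith
  then have "(rmap ^^ t) x \<in> closure (piece i)"
    using b closure_piece[OF i] by simp
  then show ?thesis using piece_unique[OF \<theta>(1) i \<theta>(2)] by simp
qed

text \<open>Angles just left and just right of an interior cut, pulled back by \<open>n\<close>
  rotation steps, read the same \<open>n\<close> letters and are then separated by the cut. Density
  yields times at which the orbit has such angles.\<close>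

lemma special_letters_rmap:
  assumes it: "is_itinerary (Suc M) piece rmap x \<theta>"
  shows "special_letters \<theta> real n = {1..M}"
proof
  have mem: "\<theta> t \<in> {1..Suc M}" for t
    using it by (auto simp: is_itinerary_def)
  show "special_letters \<theta> real n \<subseteq> {1..M}"
  proof
    fix i assume "i \<in> special_letters \<theta> real n"
    then obtain t s where "i = \<theta> (t + n)" "\<theta> (t + n) < \<theta> (s + n)"
      by (auto simp: special_letters_def)
    then show "i \<in> {1..M}" using mem[of "t + n"] mem[of "s + n"] by auto
  qed
  show "{1..M} \<subseteq> special_letters \<theta> real n"
  proof
    fix i assume i: "i \<in> {1..M}"
    obtain y0 where y0: "\<And>t y. y < y0 + real t * \<rho> \<Longrightarrow> phi y \<le> (lift ^^ t) x"
        "\<And>t y. y > y0 + real t * \<rho> \<Longrightarrow> (lift ^^ t) x < phi y"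
      using angle_exists[of x] by blast
    \<comment> \<open>The position from which the rotation reaches cut \<open>i\<close> after
      \<open>n - k\<close> further steps.\<close>
    define z where "z k = cut_pt i - real (n - k) * \<rho>" for k
    have "\<exists>j m. j \<in> {1..Suc M} \<and> cut_pt (j - 1) < z k - real M * of_int m \<and>
        z k - real M * of_int m < cut_pt j" if "k < n" for k
      using locate_mod[of "z k"] cut_backward_orbit[OF i, of "n - k"] that unfolding z_def
      by (metis One_nat_def Suc_leI zero_less_diff)
    then obtain J and m :: "nat \<Rightarrow> int" where J: "\<And>k. k < n \<Longrightarrow> J k \<in> {1..Suc M}"
        "\<And>k. k < n \<Longrightarrow> cut_pt (J k - 1) < z k - real M * of_int (m k)"
        "\<And>k. k < n \<Longrightarrow> z k - real M * of_int (m k) < cut_pt (J k)"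
      by metis
    \<comment> \<open>The distance from \<open>z k\<close>, reduced modulo \<open>M\<close>, to the
      ends of its arc; it is positive because the backward orbit avoids the cuts.\<close>
    define r where "r k = min (z k - real M * of_int (m k) - cut_pt (J k - 1))
      (cut_pt (J k) - (z k - real M * of_int (m k)))" for k
    \<comment> \<open>The two extra terms keep the angle after \<open>n\<close> steps within the two
      arcs adjacent to cut \<open>i\<close>.\<close>
    define e where "e = Min (insert (cut_pt i - cut_pt (i - 1)) (insert (cut_pt (Suc i) - cut_pt i) (r ` {..<n})))"
    have "e > 0"
      unfolding e_def using J i cut_strict_mono by (auto simp: r_def)
    have e: "e \<le> cut_pt i - cut_pt (i - 1)" "e \<le> cut_pt (Suc i) - cut_pt i" "\<And>k. k < n \<Longrightarrow> e \<le> r k"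
      unfolding e_def by (rule Min_le; simp)+
    have word: "\<theta> (t + k) = J k"
      if "z 0 - e < y0 + real t * \<rho> - real M * of_int l" "y0 + real t * \<rho> - real M * of_int l < z 0 + e"
        "k < n" for t k and l :: int
    proof -
      \<comment> \<open>Rotation preserves the offset from \<open>z 0\<close>, so an offset below
        \<open>e\<close> never leaves the arc of \<open>z k\<close>.\<close>
      have "y0 + real (t + k) * \<rho> - real M * of_int (l + m k)
          = (y0 + real t * \<rho> - real M * of_int l - z 0) + (z k - real M * of_int (m k))"
        using \<open>k < n\<close> by (simp add: z_def of_nat_diff algebra_simps)
      then show ?thesis
        using that e(3)[OF \<open>k < n\<close>]
        by (intro letter_of_angle[OF it y0 J(1), where m = "l + m k"]) (auto simp: r_def)
    qed
    have z0: "z 0 + real n * \<rho> = cut_pt i" by (simp add: z_def)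
    \<comment> \<open>Time \<open>t\<close> has its angle within \<open>e\<close> to the left of
      \<open>z 0\<close>, time \<open>s\<close> within \<open>e\<close> to the right.\<close>
    obtain t and l :: int where t: "z 0 - e - y0 < real t * \<rho> - real M * of_int l"
        "real t * \<rho> - real M * of_int l < z 0 - y0"
      by (rule rotation_dense[OF irrational M, of "z 0 - e - y0" "z 0 - y0"]) (use \<open>e > 0\<close> in auto)
    obtain s and l' :: int where s: "z 0 - y0 < real s * \<rho> - real M * of_int l'"
        "real s * \<rho> - real M * of_int l' < z 0 + e - y0"
      by (rule rotation_dense[OF irrational M, of "z 0 - y0" "z 0 + e - y0"]) (use \<open>e > 0\<close> in auto)
    have "agree \<theta> n t s"
      unfolding agree_def using word[of t l] word[of s l'] t s \<open>e > 0\<close> by auto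
    moreover have "\<theta> (t + n) = i"
    proof (rule letter_of_angle[OF it y0, where m = l])
      have "y0 + real (t + n) * \<rho> - real M * of_int l =
          (y0 + real t * \<rho> - real M * of_int l - z 0) + cut_pt i"
        using z0 by (simp add: algebra_simps)
      then show "cut_pt (i - 1) < y0 + real (t + n) * \<rho> - real M * of_int l"
        "y0 + real (t + n) * \<rho> - real M * of_int l < cut_pt i"
        using t e(1) by auto
    qed (use i in auto)
    moreover have "\<theta> (s + n) = Suc i"
    proof (rule letter_of_angle[OF it y0, where m = l'])
      have "y0 + real (s + n) * \<rho> - real M * of_int l' =
          (y0 + real s * \<rho> - real M * of_int l' - z 0) + cut_pt i"
        using z0 by (simp add: algebra_simps)
      then show "cut_pt (Suc i - 1) < y0 + real (s + n) * \<rho> - real M * of_int l'"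
        "y0 + real (s + n) * \<rho> - real M * of_int l' < cut_pt (Suc i)"
        using s e(2) by auto
    qed (use i in auto)
    ultimately show "i \<in> special_letters \<theta> real n"
      unfolding special_letters_def by (intro CollectI exI[of _ t] conjI exI[of _ s]) auto
  qed
qed

lemma complexity_rmap:
  assumes it: "is_itinerary (Suc M) piece rmap x \<theta>"
  shows "complexity \<theta> n = M * n + 1"
proof (induction n)
  case (Suc n)
  obtain g where "separated_branches {0..real M} (Suc M) piece rmap g"
    using separated_branches_exist[OF rmap_piecewise_contracting rmap_separation] .
  then interpret separated_branches "{0..real M}" "Suc M" piece rmap g .
  \<comment> \<open>The pieces are numbered from left to right here, so the label itself serves as
    key.\<close>
  have "complexity \<theta> (Suc n) = complexity \<theta> n + card (special_letters \<theta> real n)"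
  proof (rule complexity_Suc_itinerary[OF it])
    fix i j y z
    assume "i \<in> {1..Suc M}" "j \<in> {1..Suc M}" "real i < real j" "y \<in> piece i" "z \<in> piece j"
    moreover from this have "phi (cut_pt i) \<le> phi (cut_pt (j - 1))" by (intro phi_cut_mono) auto
    ultimately show "y < z" by (simp add: piece_def)
  qed (simp add: inj_on_def)
  then show ?case using Suc by (simp add: special_letters_rmap[OF it])
qed (simp add: complexity_0)

end

lemma irrational_exists: "\<exists>\<rho>::real. 0 < \<rho> \<and> \<rho> < 1 \<and> \<rho> \<notin> \<rat>"
proof (rule ccontr)
  assume "\<not> ?thesis"
  then have "{0<..<1::real} \<subseteq> \<rat>" by auto
  then show False
    using countable_subset[OF _ countable_rat] uncountable_open_interval[of 0 "1::real"] by auto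
qed

theorem theorem1:
  shows "(\<forall>(X::real set) N P f x \<theta>.
            piecewise_contracting_interval_map X N P f \<and> separation_property N P f \<and>
            x \<in> Xtilde X N P f \<and> is_itinerary N P f x \<theta> \<longrightarrow>
            (\<exists>\<alpha> \<beta> m0::nat. \<alpha> \<le> N - 1 \<and> \<beta> \<ge> 1 \<and> m0 \<ge> 1 \<and>
               (\<forall>n\<ge>m0. complexity \<theta> n = \<alpha> * n + \<beta>) \<and>
               (\<alpha> = N - 1 \<longrightarrow> \<beta> = 1)))
       \<and>
         (\<forall>N::nat. N \<ge> 2 \<longrightarrow>
            (\<exists>(X::real set) P f.
               piecewise_contracting_interval_map X N P f \<and> separation_property N P f \<and>
               (\<forall>i\<in>{1..N}. \<exists>c d::real. \<forall>y\<in>P i. f y = c * y + d) \<and>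
               (\<exists>x \<theta>. x \<in> Xtilde X N P f \<and> is_itinerary N P f x \<theta>) \<and>
               (\<forall>x \<theta>. x \<in> Xtilde X N P f \<and> is_itinerary N P f x \<theta> \<longrightarrow>
                  (\<forall>n\<ge>1. complexity \<theta> n = (N - 1) * n + 1))))"
proof (rule conjI; (intro allI impI)?)
  fix X :: "real set" and N P f x \<theta>
  assume *: "piecewise_contracting_interval_map X N P f \<and> separation_property N P f \<and>
    x \<in> Xtilde X N P f \<and> is_itinerary N P f x \<theta>"
  then obtain g where "separated_branches X N P f g"
    using separated_branches_exist by blast
  then interpret separated_branches X N P f g .
  show "\<exists>\<alpha> \<beta> m0::nat. \<alpha> \<le> N - 1 \<and> \<beta> \<ge> 1 \<and> m0 \<ge> 1 \<and>
      (\<forall>n\<ge>m0. complexity \<theta> n = \<alpha> * n + \<beta>) \<and> (\<alpha> = N - 1 \<longrightarrow> \<beta> = 1)"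
    using * by (intro complexity_eventually_affine) auto
next
  fix N :: nat
  assume "N \<ge> 2"
  then obtain M where N: "N = Suc M" "M \<ge> 1" by (cases N) auto
  obtain \<rho> :: real where "0 < \<rho>" "\<rho> < 1" "\<rho> \<notin> \<rat>"
    using irrational_exists by blast
  then interpret rotation_model \<rho> M
    using N by unfold_locales auto
  show "\<exists>(X::real set) P f.
      piecewise_contracting_interval_map X N P f \<and> separation_property N P f \<and>
      (\<forall>i\<in>{1..N}. \<exists>c d::real. \<forall>y\<in>P i. f y = c * y + d) \<and>
      (\<exists>x \<theta>. x \<in> Xtilde X N P f \<and> is_itinerary N P f x \<theta>) \<and>
      (\<forall>x \<theta>. x \<in> Xtilde X N P f \<and> is_itinerary N P f x \<theta> \<longrightarrow>
         (\<forall>n\<ge>1. complexity \<theta> n = (N - 1) * n + 1))"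
    unfolding N(1)
    by (intro exI[of _ "{0..real M}"] exI[of _ piece] exI[of _ rmap] conjI
        rmap_piecewise_contracting rmap_separation rmap_affine itinerary_exists)
      (use complexity_rmap in auto)
qed

end
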